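(* Let $\mathcal H$ be a real Hilbert space, let $(f_n)_{n\in\mathbb N}$ be a sequence in $\Gamma_0(\mathcal H)$ with $\operatorname{lev}_{\leq 0}f_n\neq\varnothing$ for every $n$, let $f\in\Gamma_0(\mathcal H)$ with $\operatorname{lev}_{\leq 0}f\neq\varnothing$, and let $U$ be a selection of the set-valued operator $x\mapsto\operatorname{Li}_n\partial f_n(x)$. Suppose that $\operatorname{epi}f_n\to\operatorname{epi}f$ in the sense of Painlevé–Kuratowski and that $f_n(x)\to f(x)$ for every $x\in\mathcal H$ with $f(x)>0$. Then: (i) $U$ is a selection of $\partial f$ and $\operatorname{dom}U\subset D$, where $D=\bigcup_{n\in\mathbb N}\bigcap_{k\geq n}\operatorname{dom}G_{f_k}^{U_k}$ for the selections $U_n$ of (ii). (ii) There exist selections $U_n$ of $\partial f_n$ $(n\in\mathbb N)$ defined on $\operatorname{dom}U$ such that $$G_{f_n}^{U_n}x\to G_f^Ux\qquad\text{for every }x\in\operatorname{Li}_n(\operatorname{lev}_{\leq 0}f_n)\cup\big(\{y\in\mathcal H:f(y)>0\}\cap\operatorname{dom}U\big).$$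
   Context: All convergences are for norm topologies. $\Gamma_0(\mathcal H)$ is the set of proper convex lower semicontinuous functions $\mathcal H\to\,]-\infty,+\infty]$; $\operatorname{lev}_{\leq 0}f=\{x: f(x)\leq 0\}$; $\operatorname{epi}f=\{(x,t)\in\mathcal H\times\mathbb R: f(x)\leq t\}$. For a sequence $(S_n)$ of subsets of a normed space, $\operatorname{Li}_nS_n$ is the set of limits of convergent sequences $(s_n)_{n\in\mathbb N}$ with $s_n\in S_n$ for every $n$; $\operatorname{Ls}_nS_n$ is the set of limits of convergent sequences $(s_k)_{k\in\mathbb N}$ with $s_k\in S_{n_k}$ for some strictly increasing sequence of indices $(n_k)$; $S_n\to S$ in the sense of Painlevé–Kuratowski means $\operatorname{Li}_nS_n=\operatorname{Ls}_nS_n=S$. $\partial f$ is the convex subdifferential. A selection of a set-valued operator $A:\mathcal H\to 2^{\mathcal H}$ is a map $U$ defined on some subset $\operatorname{dom}U\subset\{x:Ax\neq\varnothing\}$ with $Ux\in Ax$ for all $x\in\operatorname{dom}U$. For $f\in\Gamma_0(\mathcal H)$ with $\operatorname{lev}_{\leq 0}f\neq\varnothing$ and a selection $U$ of $\partial f$, $G_f^U$ is the single-valued map with domain $\operatorname{lev}_{\leq 0}f\cup\operatorname{dom}U$ given by $G_f^Ux=x$ if $f(x)\leq0$ and $G_f^Ux=x-\frac{f(x)}{\|Ux\|^2}Ux$ if $f(x)>0$ and $x\in\operatorname{dom}U$ (subgradients at points where $f>0$ are nonzero because $\operatorname{lev}_{\leq 0}f\neq\varnothing$). Thus $D$ is the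 set of points at which $G_{f_n}^{U_n}$ is defined for all sufficiently large $n$.
   Formalization: In (ii), convergence at points x of Li_n(lev_{≤0} f_n) is claimed only for x in D, i.e. where G_{f_n}^{U_n}x is defined for all large n; otherwise it can be undefined (H=ℝ, f_n the indicator function of {1/(n+1)}, f that of {0}, x=0). *)

theory Defs
  imports "HOL-Analysis.Analysis"
begin

text \<open>Extended-real-valued functions have type \<open>'a \<Rightarrow> ereal\<close>.  They may
  take the value \<open>-\<infinity>\<close> in the definitions below; membership in \<open>Gamma0\<close> excludes it.\<close>

definition epi :: "('a \<Rightarrow> ereal) \<Rightarrow> ('a \<times> real) set" where
  "epi f = {(x, t). f x \<le> ereal t}"

definition lev0 :: "('a \<Rightarrow> ereal) \<Rightarrow> 'a set" where
  "lev0 f = {x. f x \<le> 0}"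

definition proper_fun :: "('a \<Rightarrow> ereal) \<Rightarrow> bool" where
  "proper_fun f \<longleftrightarrow> (\<forall>x. f x \<noteq> -\<infinity>) \<and> (\<exists>x. f x \<noteq> \<infinity>)"

definition lsc_fun :: "('a::topological_space \<Rightarrow> ereal) \<Rightarrow> bool" where
  "lsc_fun f \<longleftrightarrow> (\<forall>x. f x \<le> Liminf (at x) f)"

definition convex_fun :: "('a::real_vector \<Rightarrow> ereal) \<Rightarrow> bool" where
  "convex_fun f \<longleftrightarrow> convex (epi f)"

definition Gamma0 :: "('a::real_normed_vector \<Rightarrow> ereal) set" where
  "Gamma0 = {f. proper_fun f \<and> convex_fun f \<and> lsc_fun f}"

definition Li :: "(nat \<Rightarrow> 'a::topological_space set) \<Rightarrow> 'a set" where
  "Li S = {x. \<exists>s. (\<forall>n. s n \<in> S n) \<and> s \<longlonglongrightarrow> x}"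

definition Ls :: "(nat \<Rightarrow> 'a::topological_space set) \<Rightarrow> 'a set" where
  "Ls S = {x. \<exists>r s. strict_mono r \<and> (\<forall>k. s k \<in> S (r k)) \<and> s \<longlonglongrightarrow> x}"

definition PK_tendsto :: "(nat \<Rightarrow> 'a::topological_space set) \<Rightarrow> 'a set \<Rightarrow> bool" where
  "PK_tendsto S T \<longleftrightarrow> Li S = T \<and> Ls S = T"

text \<open>For a proper \<open>f\<close>, the set \<open>subdiff f x\<close> is empty whenever \<open>f x = \<infinity>\<close>.\<close>

definition subdiff :: "('a::real_inner \<Rightarrow> ereal) \<Rightarrow> 'a \<Rightarrow> 'a set" where
  "subdiff f x = {u. \<forall>y. f x + ereal ((y - x) \<bullet> u) \<le> f y}"

text \<open>A partially defined single-valued map is a function into \<open>option\<close>, with domain \<open>dom\<close>.\<close>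

definition selection :: "('a \<Rightarrow> 'a set) \<Rightarrow> ('a \<rightharpoonup> 'a) \<Rightarrow> bool" where
  "selection A U \<longleftrightarrow> dom U \<subseteq> {x. A x \<noteq> {}} \<and> (\<forall>x\<in>dom U. the (U x) \<in> A x)"

text \<open>When \<open>U\<close> is a selection of \<open>subdiff f\<close> with \<open>f\<close> proper, \<open>f x\<close> is finite at every
  point of \<open>dom U\<close>, so \<open>real_of_ereal\<close> does not lose information in the second case.\<close>

definition subgrad_projector :: "('a::real_inner \<Rightarrow> ereal) \<Rightarrow> ('a \<rightharpoonup> 'a) \<Rightarrow> ('a \<rightharpoonup> 'a)" where
  "subgrad_projector f U x =
     (if f x \<le> 0 then Some x
      else map_option (\<lambda>u. x - (real_of_ereal (f x) / (norm u)\<^sup>2) *\<^sub>R u) (U x))"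

definition eventual_dom :: "(nat \<Rightarrow> ('a \<rightharpoonup> 'b)) \<Rightarrow> 'a set" where
  "eventual_dom T = (\<Union>n. \<Inter>k\<in>{n..}. dom (T k))"

text \<open>Pointwise convergence of partial maps: the limit map and all but finitely many of the
  maps \<open>T n\<close> have to be defined at \<open>x\<close>; the finitely many junk values \<open>the None\<close> are irrelevant.\<close>

definition pmap_tendsto_at :: "(nat \<Rightarrow> ('a \<rightharpoonup> 'b::topological_space)) \<Rightarrow> ('a \<rightharpoonup> 'b) \<Rightarrow> 'a \<Rightarrow> bool"
  where
  "pmap_tendsto_at T T' x \<longleftrightarrow>
     x \<in> eventual_dom T \<and> x \<in> dom T' \<and> (\<lambda>n. the (T n x)) \<longlonglongrightarrow> the (T' x)"

end

(* The inequality f_n x + <y_n - x, u_n> <= f_n y_n passes to the limit along recovery sequences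
   y_n because epigraph convergence yields f x <= liminf f_n x; this gives u in the
   subdifferential of f at x.  At points of the lower limit of the sublevel sets convergence of
   the projectors is forced by the estimate |G_n x - x| <= |x - y| for every y with f_n y <= 0,
   and at points with f x > 0 by continuity of the formula defining the projector. *)

theory Submission
  imports Defs
begin

text \<open>Testing the subgradient inequality at a point where \<open>f\<close> is not \<infinity>
  excludes \<open>f x = \<infinity>\<close>. Hence \<open>real_of_ereal\<close> is faithful in the
  projector formula.\<close>

lemma subdiff_finite:
  assumes "proper_fun f" "u \<in> subdiff f x"
  shows "\<bar>f x\<bar> \<noteq> \<infinity>"
proof -
  obtain y where y: "f y \<noteq> \<infinity>" and "f x \<noteq> -\<infinity>"
    using assms(1) by (auto simp: proper_fun_def)
  moreover have "f x + ereal ((y - x) \<bullet> u) \<le> f y"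
    using assms(2) by (auto simp: subdiff_def)
  ultimately show ?thesis by (cases "f x") auto
qed

text \<open>A zero subgradient would make \<open>x\<close> a global minimizer with positive value,
  so no point could satisfy \<open>f y \<le> 0\<close>.\<close>

lemma subdiff_nonzero:
  assumes "u \<in> subdiff f x" "f x > 0" "lev0 f \<noteq> {}"
  shows "u \<noteq> 0"
proof
  assume "u = 0"
  then have "f x \<le> f y" for y
    using assms(1) by (auto simp: subdiff_def zero_ereal_def[symmetric])
  then show False
    using assms(2,3) unfolding lev0_def by (metis empty_Collect_eq not_le order_trans)
qed

text \<open>When \<open>f x > 0\<close>, the projector maps \<open>x\<close> to its nearest point in
  the half-space of all \<open>y\<close> with \<open>f x + (y - x) \<bullet> u \<le> 0\<close>. This
  half-space contains \<open>lev0 f\<close>, so no point of \<open>lev0 f\<close> is closer to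
  \<open>x\<close>.\<close>

lemma subgrad_projector_dist_le:
  fixes f :: "'a::real_inner \<Rightarrow> ereal"
  assumes "proper_fun f" "selection (subdiff f) U" "y \<in> lev0 f"
    and "x \<in> dom (subgrad_projector f U)"
  shows "norm (the (subgrad_projector f U x) - x) \<le> norm (y - x)"
proof (cases "f x \<le> 0")
  case True
  then show ?thesis by (simp add: subgrad_projector_def)
next
  case False
  then obtain u where u: "U x = Some u"
    using assms(4) by (auto simp: subgrad_projector_def dom_def)
  then have sub: "u \<in> subdiff f x"
    using assms(2) by (force simp: selection_def)
  then obtain r where r: "f x = ereal r"
    using subdiff_finite[OF assms(1) sub] by (cases "f x") auto
  have "r > 0" using False r by simp
  have "f x > 0" "lev0 f \<noteq> {}"
    using False assms(3) by auto
  then have "u \<noteq> 0"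
    using subdiff_nonzero[OF sub] by blast
  have "f x + ereal ((y - x) \<bullet> u) \<le> f y"
    using sub by (simp add: subdiff_def)
  also have "f y \<le> 0"
    using assms(3) by (simp add: lev0_def)
  finally have "f x + ereal ((y - x) \<bullet> u) \<le> 0" .
  then have "r + (y - x) \<bullet> u \<le> 0" using r by simp
  then have "r \<le> norm (y - x) * norm u"
    using Cauchy_Schwarz_ineq2[of "y - x" u] by linarith
  then have "r / norm u \<le> norm (y - x)"
    using \<open>u \<noteq> 0\<close> by (simp add: field_simps)
  moreover have "norm (the (subgrad_projector f U x) - x) = r / norm u"
    using False u r \<open>r > 0\<close> \<open>u \<noteq> 0\<close>
    by (simp add: subgrad_projector_def power2_eq_square)
  ultimately show ?thesis by simp
qed

text \<open>The constant sequence \<open>(x, c)\<close>, with the first \<open>N\<close> indices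
  skipped, witnesses membership in the upper limit. This is the liminf half of epigraph
  convergence.\<close>

lemma Ls_epi_le:
  fixes fn :: "nat \<Rightarrow> 'a::real_normed_vector \<Rightarrow> ereal"
  assumes "Ls (\<lambda>n. epi (fn n)) = epi f" "\<forall>\<^sub>F n in sequentially. fn n x \<le> ereal c"
  shows "f x \<le> ereal c"
proof -
  obtain N where N: "\<And>n. n \<ge> N \<Longrightarrow> fn n x \<le> ereal c"
    using assms(2) by (auto simp: eventually_sequentially)
  have "(x, c) \<in> Ls (\<lambda>n. epi (fn n))"
    unfolding Ls_def
    by (rule CollectI, rule exI[of _ "\<lambda>k. k + N"], rule exI[of _ "\<lambda>_. (x, c)"])
      (auto simp: strict_mono_def epi_def N)
  then show ?thesis using assms(1) by (simp add: epi_def)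
qed

lemma Li_subdiff_subset_subdiff:
  fixes fn :: "nat \<Rightarrow> 'a::real_inner \<Rightarrow> ereal"
  assumes epi: "PK_tendsto (\<lambda>n. epi (fn n)) (epi f)"
    and proper: "\<And>n. proper_fun (fn n)" "proper_fun f"
  shows "Li (\<lambda>n. subdiff (fn n) x) \<subseteq> subdiff f x"
proof
  fix u assume "u \<in> Li (\<lambda>n. subdiff (fn n) x)"
  then obtain s where s: "\<And>n. s n \<in> subdiff (fn n) x" and s_lim: "s \<longlonglongrightarrow> u"
    by (auto simp: Li_def)
  have "f x + ereal ((y - x) \<bullet> u) \<le> f y" for y
  \<comment> \<open>Only a finite \<open>f y\<close> needs work: \<infinity> is trivial and
    properness excludes the other case.\<close>
  proof (cases "f y")
    case (real t)
    then have "(y, t) \<in> Li (\<lambda>n. epi (fn n))"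
      using epi by (simp add: PK_tendsto_def epi_def)
    then obtain z where z: "\<And>n. z n \<in> epi (fn n)" and z_lim: "z \<longlonglongrightarrow> (y, t)"
      by (auto simp: Li_def)
    \<comment> \<open>\<open>b n\<close> is the bound on \<open>fn n x\<close> from the subgradient
      inequality at the recovery point \<open>fst (z n)\<close>, with height
      \<open>snd (z n)\<close> in place of the function value.\<close>
    define b where "b n = snd (z n) - (fst (z n) - x) \<bullet> s n" for n
    have b_lim: "b \<longlonglongrightarrow> t - (y - x) \<bullet> u"
      unfolding b_def using tendsto_fst[OF z_lim] tendsto_snd[OF z_lim] s_lim
      by (auto intro!: tendsto_intros)
    have fn_le: "fn n x \<le> ereal (b n)" for n
    proof -
      have "fn n x + ereal ((fst (z n) - x) \<bullet> s n) \<le> fn n (fst (z n))"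
        using s[of n] by (auto simp: subdiff_def)
      also have "\<dots> \<le> ereal (snd (z n))"
        using z[of n] by (auto simp: epi_def)
      finally show ?thesis
        by (cases "fn n x") (auto simp: b_def)
    qed
    \<comment> \<open>The slack \<open>e\<close> is needed because \<open>Ls_epi_le\<close> takes a
      fixed bound, while \<open>b n\<close> may approach its limit from above.\<close>
    have "f x \<le> ereal (t - (y - x) \<bullet> u + e)" if "e > 0" for e
    proof (rule Ls_epi_le)
      show "Ls (\<lambda>n. epi (fn n)) = epi f"
        using epi by (simp add: PK_tendsto_def)
      have "\<forall>\<^sub>F n in sequentially. b n < t - (y - x) \<bullet> u + e"
        using order_tendstoD(2)[OF b_lim] that by simp
      then show "\<forall>\<^sub>F n in sequentially. fn n x \<le> ereal (t - (y - x) \<bullet> u + e)"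
        by eventually_elim (meson fn_le ereal_less_eq(3) less_imp_le order_trans)
    qed
    then have "f x \<le> ereal (t - (y - x) \<bullet> u)"
      by - (rule ereal_le_epsilon2, simp)
    then show ?thesis using real by (cases "f x") simp_all
  qed (use proper(2) in \<open>auto simp: proper_fun_def\<close>)
  then show "u \<in> subdiff f x" by (simp add: subdiff_def)
qed

text \<open>Points of the sublevel sets lift to height 0 in the epigraphs, where the lower limit is
  known.\<close>

lemma Li_lev0_subset_lev0:
  fixes fn :: "nat \<Rightarrow> 'a::real_normed_vector \<Rightarrow> ereal"
  assumes "Li (\<lambda>n. epi (fn n)) = epi f"
  shows "Li (\<lambda>n. lev0 (fn n)) \<subseteq> lev0 f"
proof
  fix x assume "x \<in> Li (\<lambda>n. lev0 (fn n))"
  then obtain z where "\<And>n. z n \<in> lev0 (fn n)" "z \<longlonglongrightarrow> x"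
    by (auto simp: Li_def)
  then have "(x, 0) \<in> Li (\<lambda>n. epi (fn n))"
    unfolding Li_def
    by (intro CollectI exI[of _ "\<lambda>n. (z n, 0)"])
      (auto simp: lev0_def epi_def zero_ereal_def intro!: tendsto_intros)
  then show "x \<in> lev0 f"
    using assms by (simp add: lev0_def epi_def zero_ereal_def)
qed

text \<open>The eventual domain depends on \<open>Us\<close>, so it occurs under the existential. It
  also cuts down the lower limit of the sublevel sets: at such a point \<open>fn n x\<close> may
  stay positive, even infinite, and the projectors may be undefined.\<close>

theorem proposition4p12:
  fixes f :: "'a::{real_inner, complete_space} \<Rightarrow> ereal"
    and fn :: "nat \<Rightarrow> 'a \<Rightarrow> ereal"
    and U :: "'a \<rightharpoonup> 'a"
  assumes fn_Gamma0: "\<And>n. fn n \<in> Gamma0"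
    and lev_fn: "\<And>n. lev0 (fn n) \<noteq> {}"
    and f_Gamma0: "f \<in> Gamma0"
    and lev_f: "lev0 f \<noteq> {}"
    and U_sel: "selection (\<lambda>x. Li (\<lambda>n. subdiff (fn n) x)) U"
    and epi_conv: "PK_tendsto (\<lambda>n. epi (fn n)) (epi f)"
    and pointwise_conv: "\<And>x. f x > 0 \<Longrightarrow> (\<lambda>n. fn n x) \<longlonglongrightarrow> f x"
  shows "selection (subdiff f) U \<and>
    (\<exists>Us.
       (\<forall>n. selection (subdiff (fn n)) (Us n) \<and> dom (Us n) = dom U) \<and>
       dom U \<subseteq> eventual_dom (\<lambda>n. subgrad_projector (fn n) (Us n)) \<and>
       (\<forall>x \<in> (Li (\<lambda>n. lev0 (fn n)) \<inter> eventual_dom (\<lambda>n. subgrad_projector (fn n) (Us n)))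
              \<union> ({y. f y > 0} \<inter> dom U).
          pmap_tendsto_at (\<lambda>n. subgrad_projector (fn n) (Us n)) (subgrad_projector f U) x))"
proof -
  have proper: "proper_fun (fn n)" "proper_fun f" for n
    using fn_Gamma0 f_Gamma0 by (auto simp: Gamma0_def)
  have U_Li: "the (U x) \<in> Li (\<lambda>n. subdiff (fn n) x)" if "x \<in> dom U" for x
    using U_sel that by (simp add: selection_def)
  then have U_sub: "the (U x) \<in> subdiff f x" if "x \<in> dom U" for x
    using Li_subdiff_subset_subdiff[OF epi_conv proper] that by blast
  then have U_selection: "selection (subdiff f) U"
    by (auto simp: selection_def)
  have "\<forall>x\<in>dom U. \<exists>s. (\<forall>n. s n \<in> subdiff (fn n) x) \<and> s \<longlonglongrightarrow> the (U x)"
    using U_Li by (simp add: Li_def)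
  then obtain S where S: "\<And>x n. x \<in> dom U \<Longrightarrow> S x n \<in> subdiff (fn n) x"
    and S_lim: "\<And>x. x \<in> dom U \<Longrightarrow> S x \<longlonglongrightarrow> the (U x)"
    by metis
  \<comment> \<open>One approximating sequence \<open>S x\<close> is fixed per point, and its
    \<open>n\<close>-th term serves as the value of the \<open>n\<close>-th selection.\<close>
  define Us where "Us n x = (if x \<in> dom U then Some (S x n) else None)" for n x
  have dom_Us: "dom (Us n) = dom U" for n
    by (auto simp: Us_def dom_def)
  have Us_sel: "selection (subdiff (fn n)) (Us n)" for n
    unfolding selection_def dom_Us using S by (force simp: Us_def)
  let ?G = "\<lambda>n. subgrad_projector (fn n) (Us n)"
  have dom_G: "x \<in> dom (?G n)" if "x \<in> dom U" for n x
    using that by (auto simp: subgrad_projector_def Us_def)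
  then have dom_sub: "dom U \<subseteq> eventual_dom ?G"
    unfolding eventual_dom_def by blast
  have conv_Li: "pmap_tendsto_at ?G (subgrad_projector f U) x"
    if x: "x \<in> Li (\<lambda>n. lev0 (fn n))" "x \<in> eventual_dom ?G" for x
  proof -
    obtain z where z: "\<And>n. z n \<in> lev0 (fn n)" and z_lim: "z \<longlonglongrightarrow> x"
      using x(1) by (auto simp: Li_def)
    \<comment> \<open>The limit map fixes \<open>x\<close>, so it remains to show that the
      displacements of \<open>x\<close> under \<open>?G n\<close> vanish.\<close>
    have "f x \<le> 0"
      using Li_lev0_subset_lev0[of fn f] epi_conv x(1) by (auto simp: PK_tendsto_def lev0_def)
    then have G_x: "subgrad_projector f U x = Some x"
      by (simp add: subgrad_projector_def)
    obtain N where N: "\<And>n. n \<ge> N \<Longrightarrow> x \<in> dom (?G n)"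
      using x(2) unfolding eventual_dom_def by blast
    have "\<forall>\<^sub>F n in sequentially. norm (the (?G n x) - x) \<le> norm (z n - x)"
      using eventually_ge_at_top[of N]
      by eventually_elim (intro subgrad_projector_dist_le proper Us_sel z N)
    moreover have "(\<lambda>n. norm (z n - x)) \<longlonglongrightarrow> 0"
      using z_lim by (simp add: LIM_zero tendsto_norm_zero)
    ultimately have "(\<lambda>n. the (?G n x) - x) \<longlonglongrightarrow> 0"
      by (rule Lim_null_comparison)
    then show ?thesis
      using x(2) G_x by (auto simp: pmap_tendsto_at_def LIM_zero_iff)
  qed
  have conv_pos: "pmap_tendsto_at ?G (subgrad_projector f U) x"
    if x: "f x > 0" "x \<in> dom U" for x
  proof -
    obtain u where u: "U x = Some u" using x(2) by auto
    then have u_sub: "u \<in> subdiff f x" and S_u: "S x \<longlonglongrightarrow> u"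
      using U_sub[OF x(2)] S_lim[OF x(2)] by auto
    have "u \<noteq> 0" using subdiff_nonzero[OF u_sub x(1) lev_f] .
    have fin: "\<bar>f x\<bar> \<noteq> \<infinity>"
      using subdiff_finite[OF proper(2) u_sub] .
    have fn_lim: "(\<lambda>n. fn n x) \<longlonglongrightarrow> f x"
      using pointwise_conv[OF x(1)] .
    then have "(\<lambda>n. fn n x) \<longlonglongrightarrow> ereal (real_of_ereal (f x))"
      using fin by (simp add: ereal_real')
    then have "(\<lambda>n. real_of_ereal (fn n x)) \<longlonglongrightarrow> real_of_ereal (f x)"
      by (rule lim_real_of_ereal)
    \<comment> \<open>The quotient is continuous at the limit since \<open>u \<noteq> 0\<close>;
      \<open>S x n\<close> can vanish for only finitely many \<open>n\<close>.\<close>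
    then have "(\<lambda>n. x - (real_of_ereal (fn n x) / (norm (S x n))\<^sup>2) *\<^sub>R S x n)
        \<longlonglongrightarrow> x - (real_of_ereal (f x) / (norm u)\<^sup>2) *\<^sub>R u"
      using S_u \<open>u \<noteq> 0\<close> by (auto intro!: tendsto_intros)
    \<comment> \<open>Eventually \<open>fn n x > 0\<close>, so the projector takes its subgradient
      branch; for earlier \<open>n\<close> it may be the identity at \<open>x\<close>.\<close>
    moreover have "\<forall>\<^sub>F n in sequentially.
        x - (real_of_ereal (fn n x) / (norm (S x n))\<^sup>2) *\<^sub>R S x n = the (?G n x)"
      using order_tendstoD(1)[OF fn_lim x(1)]
      by eventually_elim (use x(2) in \<open>auto simp: subgrad_projector_def Us_def\<close>)
    ultimately have "(\<lambda>n. the (?G n x)) \<longlonglongrightarrow> x - (real_of_ereal (f x) / (norm u)\<^sup>2) *\<^sub>R u"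
      by (rule Lim_transform_eventually)
    then show ?thesis
      using dom_sub x u by (auto simp: pmap_tendsto_at_def subgrad_projector_def)
  qed
  show ?thesis
  proof (intro conjI exI[of _ Us] allI ballI)
    fix x assume "x \<in> Li (\<lambda>n. lev0 (fn n)) \<inter> eventual_dom ?G \<union> {y. f y > 0} \<inter> dom U"
    then show "pmap_tendsto_at ?G (subgrad_projector f U) x"
      using conv_Li conv_pos by blast
  qed (fact U_selection Us_sel dom_Us dom_sub)+
qed

end
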